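(* Let $A\subseteq\mathbb{N}$ satisfy $\operatorname{\ell BD}(A)>0$ and fix $l\in\mathbb{N}$. Then there exists $n\in\mathbb{N}$ such that for every $m\in\mathbb{N}$ there is a geometric progression $G=\{ar^i: i=0,1,\ldots,l-1\}$ with $a,r>m$ such that $G$ is an $n$-approximate subset of $A$.
   Context: $\mathbb{N}=\{1,2,3,\dots\}$. For $A\subseteq\mathbb{N}$, the (upper) Banach log density is $\operatorname{\ell BD}(A)=\lim_{n\to\infty}\sup_{k\ge1}\frac{1}{\ln n}\sum_{x\in A\cap[k,nk]}\frac1x$ (this limit exists). For $n\in\mathbb{N}$, a number $x$ is an $n$-approximation of $a$ if $x/n<a<xn$; a set $X$ is an $n$-approximate subset of $A$ if every $x\in X$ is an $n$-approximation of some $a\in A$. *)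

theory Defs
  imports "HOL-Analysis.Analysis"
begin

(* For n >= 2 the set under the supremum is bounded above by (1 + ln n) / ln n, and it is {0}
   for n < 2 (division by ln n = 0), so the real-valued SUP is a genuine supremum. *)
definition banach_log_density :: "nat set \<Rightarrow> real" where
  "banach_log_density A =
     lim (\<lambda>n::nat. SUP k\<in>{1::nat..}. 1 / ln (real n) * (\<Sum>x\<in>A \<inter> {k..n * k}. 1 / real x))"

definition is_approximation :: "nat \<Rightarrow> real \<Rightarrow> real \<Rightarrow> bool" where
  "is_approximation n x a \<longleftrightarrow> x / real n < a \<and> a < x * real n"

definition approximate_subset :: "nat \<Rightarrow> nat set \<Rightarrow> nat set \<Rightarrow> bool" where
  "approximate_subset n X A \<longleftrightarrow> (\<forall>x\<in>X. \<exists>a\<in>A. is_approximation n (real x) (real a))"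

end

theory Submission
  imports Defs
begin

text \<open>
  Let \<open>f n\<close> be the supremum over \<open>k\<close> of the sum of \<open>1/x\<close> over \<open>x \<in> A \<inter> [k, nk]\<close>. Since
  \<open>[k, mnk]\<close> is covered by \<open>[k, mk]\<close> and \<open>[mk, nmk]\<close>, \<open>f (mn) \<le> f m + f n\<close>, so as in Fekete's
  lemma \<open>f n / ln n\<close> converges to its infimum \<open>\<delta> > 0\<close>. Choose \<open>M\<close> with
  \<open>(1 - \<epsilon>) f M < \<delta> ln M\<close>. For every \<open>q\<close> we then have \<open>f (M\<^sup>q) \<ge> \<delta> q ln M > (1 - \<epsilon>) q f M\<close>, so some
  window \<open>[k, M\<^sup>q k]\<close> carries weight more than \<open>(1 - \<epsilon>) q f M\<close>. Each of its \<open>q\<close> blocks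
  \<open>[M\<^sup>j k, M\<^sup>j\<^sup>+\<^sup>1 k]\<close> carries at most \<open>f M\<close>, so fewer than \<open>\<epsilon>q\<close> of them miss \<open>A\<close>. For
  \<open>\<epsilon> = 1/(2l+1)\<close> and \<open>q\<close> large, a union bound yields \<open>j\<close> such that the blocks with indices
  \<open>j, j + m, \<dots>, j + (l-1)m\<close> all meet \<open>A\<close>, and the progression starting at \<open>M\<^sup>j k\<close> with ratio \<open>M\<^sup>m\<close>
  is \<open>(M+1)\<close>-approximated by \<open>A\<close>. Szemeredi's theorem is not needed because \<open>M\<close> may depend on \<open>l\<close>.
\<close>

locale log_subadditive =
  fixes f :: "nat \<Rightarrow> real"
  assumes mono: "mono_on {2..} f"
    and mult_le_add: "\<And>m n. \<lbrakk>2 \<le> m; 2 \<le> n\<rbrakk> \<Longrightarrow> f (m * n) \<le> f m + f n"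
begin

lemma nonneg:
  assumes "2 \<le> n"
  shows "0 \<le> f n"
proof -
  have "f n \<le> f (n * n)"
    using assms by (intro mono_onD[OF mono]) (auto intro: order_trans)
  also have "\<dots> \<le> f n + f n"
    using assms by (intro mult_le_add)
  finally show ?thesis by simp
qed

lemma power_le:
  assumes "2 \<le> M" "1 \<le> q"
  shows "f (M ^ q) \<le> real q * f M"
  using assms(2)
proof (induction q rule: dec_induct)
  case base
  show ?case by simp
next
  case (step q)
  have "2 \<le> M ^ q"
    using assms(1) step.hyps self_le_power[of M q] by linarith
  then have "f (M * M ^ q) \<le> f M + f (M ^ q)"
    by (rule mult_le_add[OF assms(1)])
  with step.IH show ?case by (simp add: algebra_simps)
qed

lemma div_ln_le:
  assumes M: "2 \<le> M" and n: "2 \<le> n"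
  shows "f n / ln (real n) \<le> f M / ln (real M) + f M / ln (real n)"
proof -
  obtain q where lower: "M ^ q \<le> n" and upper: "n < M ^ (q + 1)"
    using ex_power_ivl1[of M n] M n by auto
  have "real q * ln (real M) = ln (real (M ^ q))"
    using M by (simp add: ln_realpow)
  also have "\<dots> \<le> ln (real n)"
    using lower M n by (intro ln_mono) (simp_all only: of_nat_le_iff of_nat_0_less_iff zero_less_power)
  finally have q_le: "real q \<le> ln (real n) / ln (real M)"
    using M by (simp add: field_simps)
  have "f n \<le> f (M ^ (q + 1))"
    using upper n by (intro mono_onD[OF mono]) auto
  also have "\<dots> \<le> real (q + 1) * f M"
    using M by (intro power_le) auto
  also have "\<dots> \<le> (ln (real n) / ln (real M) + 1) * f M"
    using q_le nonneg[OF M] by (intro mult_right_mono) auto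
  finally have "f n / ln (real n) \<le> (ln (real n) / ln (real M) + 1) * f M / ln (real n)"
    using n by (intro divide_right_mono) auto
  also have "\<dots> = f M / ln (real M) + f M / ln (real n)"
    using n by (simp add: field_simps)
  finally show ?thesis .
qed

lemma bdd_below_div_ln: "bdd_below ((\<lambda>n. f n / ln (real n)) ` {2..})"
  by (rule bdd_belowI2[of _ 0]) (simp add: nonneg)

lemma div_ln_tendsto_INF:
  "(\<lambda>n. f n / ln (real n)) \<longlonglongrightarrow> (INF n\<in>{2..}. f n / ln (real n))" (is "_ \<longlonglongrightarrow> ?\<delta>")
proof (rule order_tendstoI)
  fix a assume "a < ?\<delta>"
  then show "\<forall>\<^sub>F n in sequentially. a < f n / ln (real n)"
    by (intro eventually_sequentiallyI[of 2])
      (auto intro: less_le_trans[OF _ cINF_lower[OF bdd_below_div_ln]])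
next
  fix a assume "?\<delta> < a"
  then obtain M where M: "2 \<le> M" "f M / ln (real M) < a"
    using cINF_less_iff[OF _ bdd_below_div_ln] by fastforce
  have "filterlim (\<lambda>n. ln (real n)) at_top sequentially"
    by (rule filterlim_compose[OF ln_at_top filterlim_real_sequentially])
  then have "(\<lambda>n. f M / ln (real M) + f M / ln (real n)) \<longlonglongrightarrow> f M / ln (real M) + 0"
    by (intro tendsto_intros real_tendsto_divide_at_top[OF tendsto_const])
  then have "\<forall>\<^sub>F n in sequentially. f M / ln (real M) + f M / ln (real n) < a"
    using M(2) by (intro order_tendstoD(2)) auto
  then show "\<forall>\<^sub>F n in sequentially. f n / ln (real n) < a"
    using eventually_ge_at_top[of 2]
    by eventually_elim (rule le_less_trans[OF div_ln_le[OF M(1)]])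
qed

lemma lim_div_ln_mult_ln_le:
  assumes "2 \<le> n"
  shows "lim (\<lambda>n. f n / ln (real n)) * ln (real n) \<le> f n"
proof -
  have "lim (\<lambda>n. f n / ln (real n)) = (INF n\<in>{2..}. f n / ln (real n))"
    by (rule limI[OF div_ln_tendsto_INF])
  also have "\<dots> \<le> f n / ln (real n)"
    using assms by (intro cINF_lower bdd_below_div_ln) auto
  finally show ?thesis using assms by (simp add: field_simps)
qed

lemma ex_mult_less_lim_mult_ln:
  assumes pos: "0 < lim (\<lambda>n. f n / ln (real n))" and "\<theta> < 1"
  shows "\<exists>M\<ge>2. \<theta> * f M < lim (\<lambda>n. f n / ln (real n)) * ln (real M)"
proof -
  define \<delta> where "\<delta> = lim (\<lambda>n. f n / ln (real n))"
  have "(\<lambda>n. \<theta> * (f n / ln (real n))) \<longlonglongrightarrow> \<theta> * \<delta>"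
    unfolding \<delta>_def limI[OF div_ln_tendsto_INF]
    by (rule tendsto_mult_left[OF div_ln_tendsto_INF])
  moreover have "\<theta> * \<delta> < \<delta>"
    using pos \<open>\<theta> < 1\<close> by (simp add: \<delta>_def)
  ultimately have "\<forall>\<^sub>F n in sequentially. \<theta> * (f n / ln (real n)) < \<delta>"
    by (rule order_tendstoD(2))
  with eventually_ge_at_top[of 2]
  have "\<forall>\<^sub>F n in sequentially. 2 \<le> n \<and> \<theta> * f n < \<delta> * ln (real n)"
    by eventually_elim (simp add: field_simps)
  then show ?thesis
    unfolding \<delta>_def by (auto dest: eventually_happens)
qed

end

lemma real_SUP_mult_left:
  fixes f :: "'a \<Rightarrow> real"
  assumes "0 \<le> c" "I \<noteq> {}" "bdd_above (f ` I)"
  shows "(SUP i\<in>I. c * f i) = c * (SUP i\<in>I. f i)"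
  using continuous_at_Sup_mono[of "(*) c" "f ` I"] assms
  by (simp add: image_image monoI mult_left_mono continuous_intros)

definition log_weight :: "nat set \<Rightarrow> nat \<Rightarrow> nat \<Rightarrow> real" where
  "log_weight A k n = (\<Sum>x\<in>A \<inter> {k..n * k}. 1 / real x)"

definition sup_log_weight :: "nat set \<Rightarrow> nat \<Rightarrow> real" where
  "sup_log_weight A n = (SUP k\<in>{1..}. log_weight A k n)"

lemma log_weight_le:
  assumes "1 \<le> k"
  shows "log_weight A k n \<le> real n"
proof -
  have "log_weight A k n \<le> real (card (A \<inter> {k..n * k})) * (1 / real k)"
    unfolding log_weight_def using assms by (intro sum_bounded_above) (auto simp: frac_le)
  also have "card (A \<inter> {k..n * k}) \<le> card {k..n * k}"
    by (intro card_mono) auto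
  also have "\<dots> \<le> n * k"
    using assms by simp
  finally show ?thesis using assms by (simp add: field_simps)
qed

lemma log_weight_mono: "n \<le> n' \<Longrightarrow> log_weight A k n \<le> log_weight A k n'"
  unfolding log_weight_def by (intro sum_mono2) (auto elim!: order_trans)

lemma log_weight_mult_le: "log_weight A k (m * n) \<le> log_weight A k m + log_weight A (m * k) n"
proof -
  let ?I = "A \<inter> {k..m * k}" and ?J = "A \<inter> {m * k..n * (m * k)}"
  have "log_weight A k (m * n) \<le> (\<Sum>x\<in>?I \<union> ?J. 1 / real x)"
    unfolding log_weight_def by (intro sum_mono2) (auto simp: mult_ac)
  also have "\<dots> \<le> log_weight A k m + log_weight A (m * k) n"
    unfolding log_weight_def by (subst sum_Un) (auto intro!: sum_nonneg)
  finally show ?thesis .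
qed

lemma bdd_above_log_weight: "bdd_above ((\<lambda>k. log_weight A k n) ` {1..})"
  by (rule bdd_aboveI2[of _ _ "real n"]) (simp add: log_weight_le)

lemma log_weight_le_sup: "1 \<le> k \<Longrightarrow> log_weight A k n \<le> sup_log_weight A n"
  unfolding sup_log_weight_def by (intro cSUP_upper bdd_above_log_weight) simp

lemma less_sup_log_weight_iff: "c < sup_log_weight A n \<longleftrightarrow> (\<exists>k\<ge>1. c < log_weight A k n)"
  unfolding sup_log_weight_def
  by (subst less_cSUP_iff[OF _ bdd_above_log_weight]) auto

lemma log_subadditive_sup_log_weight: "log_subadditive (sup_log_weight A)"
proof
  show "mono_on {2..} (sup_log_weight A)"
    unfolding sup_log_weight_def
    by (intro mono_onI cSUP_mono bdd_above_log_weight) (auto intro: log_weight_mono)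
next
  fix m n :: nat assume "2 \<le> m" "2 \<le> n"
  show "sup_log_weight A (m * n) \<le> sup_log_weight A m + sup_log_weight A n"
    unfolding sup_log_weight_def[of A "m * n"]
  proof (rule cSUP_least)
    fix k :: nat assume "k \<in> {1..}"
    with \<open>2 \<le> m\<close> show "log_weight A k (m * n) \<le> sup_log_weight A m + sup_log_weight A n"
      by (intro order_trans[OF log_weight_mult_le] add_mono log_weight_le_sup) auto
  qed simp
qed

lemma banach_log_density_eq_lim:
  "banach_log_density A = lim (\<lambda>n. sup_log_weight A n / ln (real n))"
proof -
  have "(SUP k\<in>{1..}. 1 / ln (real n) * log_weight A k n) = sup_log_weight A n / ln (real n)" for n
    unfolding sup_log_weight_def
    by (subst real_SUP_mult_left[OF _ _ bdd_above_log_weight]) (cases n, auto)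
  then show ?thesis
    by (simp add: banach_log_density_def flip: log_weight_def)
qed

definition empty_blocks :: "nat set \<Rightarrow> nat \<Rightarrow> nat \<Rightarrow> nat \<Rightarrow> nat set" where
  "empty_blocks A M k q = {j. j < q \<and> A \<inter> {M ^ j * k..M * (M ^ j * k)} = {}}"

lemma empty_blocks_subset: "empty_blocks A M k q \<subseteq> {..<q}"
  by (auto simp: empty_blocks_def)

lemma finite_empty_blocks: "finite (empty_blocks A M k q)"
  by (simp add: empty_blocks_def)

lemma log_weight_power_le_sum:
  assumes "1 \<le> q"
  shows "log_weight A k (M ^ q) \<le> (\<Sum>j<q. log_weight A (M ^ j * k) M)"
  using assms
proof (induction q rule: dec_induct)
  case base
  show ?case by simp
next
  case (step q)
  have "log_weight A k (M ^ Suc q) \<le> log_weight A k (M ^ q) + log_weight A (M ^ q * k) M"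
    using log_weight_mult_le[of A k "M ^ q" M] by (simp add: mult.commute)
  with step.IH show ?case by simp
qed

lemma log_weight_power_le_nonempty_blocks:
  assumes "1 \<le> M" "1 \<le> k" "1 \<le> q"
  shows "log_weight A k (M ^ q)
    \<le> (real q - real (card (empty_blocks A M k q))) * sup_log_weight A M"
proof -
  let ?E = "empty_blocks A M k q"
  have "log_weight A k (M ^ q) \<le> (\<Sum>j<q. log_weight A (M ^ j * k) M)"
    by (rule log_weight_power_le_sum[OF \<open>1 \<le> q\<close>])
  also have "\<dots> = (\<Sum>j\<in>{..<q} - ?E. log_weight A (M ^ j * k) M)"
    by (intro sum.mono_neutral_right) (auto simp: empty_blocks_def log_weight_def)
  also have "\<dots> \<le> real (card ({..<q} - ?E)) * sup_log_weight A M"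
    using assms by (intro sum_bounded_above log_weight_le_sup) auto
  also have "real (card ({..<q} - ?E)) = real q - real (card ?E)"
    using card_mono[OF _ empty_blocks_subset[of A M k q]]
    by (simp add: card_Diff_subset finite_empty_blocks empty_blocks_subset of_nat_diff)
  finally show ?thesis .
qed

lemma ex_few_empty_blocks:
  assumes "0 < banach_log_density A" and "0 < \<epsilon>"
  shows "\<exists>M\<ge>2. \<forall>q\<ge>1. \<exists>k\<ge>1. real (card (empty_blocks A M k q)) < \<epsilon> * real q"
proof -
  interpret log_subadditive "sup_log_weight A"
    by (rule log_subadditive_sup_log_weight)
  define \<delta> where "\<delta> = banach_log_density A"
  obtain M where "2 \<le> M" and M: "(1 - \<epsilon>) * sup_log_weight A M < \<delta> * ln (real M)"
    using ex_mult_less_lim_mult_ln[of "1 - \<epsilon>"] assms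
    unfolding \<delta>_def banach_log_density_eq_lim by auto
  have "\<exists>k\<ge>1. real (card (empty_blocks A M k q)) < \<epsilon> * real q" if "1 \<le> q" for q
  proof -
    have "2 \<le> M ^ q"
      using \<open>2 \<le> M\<close> \<open>1 \<le> q\<close> self_le_power[of M q] by linarith
    have "real q * (1 - \<epsilon>) * sup_log_weight A M < real q * (\<delta> * ln (real M))"
      using M \<open>1 \<le> q\<close> by (simp add: mult.assoc)
    also have "\<dots> = \<delta> * ln (real (M ^ q))"
      using \<open>2 \<le> M\<close> by (simp add: ln_realpow)
    also have "\<dots> \<le> sup_log_weight A (M ^ q)"
      unfolding \<delta>_def banach_log_density_eq_lim by (rule lim_div_ln_mult_ln_le[OF \<open>2 \<le> M ^ q\<close>])
    finally obtain k where "1 \<le> k"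
      and heavy: "real q * (1 - \<epsilon>) * sup_log_weight A M < log_weight A k (M ^ q)"
      unfolding less_sup_log_weight_iff by blast
    note heavy
    also have "log_weight A k (M ^ q)
        \<le> (real q - real (card (empty_blocks A M k q))) * sup_log_weight A M"
      using \<open>2 \<le> M\<close> \<open>1 \<le> k\<close> \<open>1 \<le> q\<close> by (intro log_weight_power_le_nonempty_blocks) auto
    finally have "real q * (1 - \<epsilon>) < real q - real (card (empty_blocks A M k q))"
      by (rule mult_right_less_imp_less[OF _ nonneg[OF \<open>2 \<le> M\<close>]])
    then have "real (card (empty_blocks A M k q)) < \<epsilon> * real q"
      by (simp add: algebra_simps)
    with \<open>1 \<le> k\<close> show ?thesis by blast
  qed
  with \<open>2 \<le> M\<close> show ?thesis by blast
qed

lemma ex_translate_avoiding: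
  fixes J S E :: "'a::cancel_semigroup_add set"
  assumes "finite S" "finite E" and card: "card S * card E < card J"
  shows "\<exists>j\<in>J. \<forall>s\<in>S. j + s \<notin> E"
proof (rule ccontr)
  let ?hit = "\<lambda>s. (\<lambda>j. j + s) -` E"
  assume "\<not> ?thesis"
  then have cover: "J \<subseteq> (\<Union>s\<in>S. ?hit s)" by auto
  have inj: "inj (\<lambda>j. j + s)" for s :: 'a by (simp add: inj_def)
  have "card J \<le> card (\<Union>s\<in>S. ?hit s)"
    using assms cover by (intro card_mono finite_UN_I finite_vimageI inj)
  also have "\<dots> \<le> (\<Sum>s\<in>S. card (?hit s))"
    by (rule card_UN_le[OF \<open>finite S\<close>])
  also have "\<dots> \<le> card S * card E"
    using sum_bounded_above[of S "\<lambda>s. card (?hit s)"] card_vimage_inj_on_le[OF inj \<open>finite E\<close>]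
    by simp
  finally show False using card by simp
qed

lemma ex_geometric_progression_few_empty_blocks:
  assumes "2 \<le> M" "1 \<le> k" and card: "l * card (empty_blocks A M k q) + (l + 1) * m < q"
  shows "\<exists>a>m. \<exists>r>m. \<forall>i<l. A \<inter> {a * r ^ i..M * (a * r ^ i)} \<noteq> {}"
proof -
  let ?S = "(\<lambda>i. i * m) ` {..<l}" and ?E = "empty_blocks A M k q"
  have "card ?S * card ?E \<le> l * card ?E"
    using card_image_le[of "{..<l}" "\<lambda>i. i * m"] by simp
  also have "\<dots> < card {m..<q - l * m}"
    using card by simp
  finally obtain j where j: "m \<le> j" "j + l * m < q" and avoid: "\<And>i. i < l \<Longrightarrow> j + i * m \<notin> ?E"
    using ex_translate_avoiding[OF _ finite_empty_blocks, of ?S A M k q "{m..<q - l * m}"] by auto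
  let ?a = "M ^ j * k" and ?r = "M ^ m"
  have "m < 2 ^ m" by simp
  also have "\<dots> \<le> ?r" using \<open>2 \<le> M\<close> by (rule power_mono) simp
  finally have "m < ?r" .
  also have "\<dots> \<le> M ^ j" using \<open>2 \<le> M\<close> j(1) by (intro power_increasing) auto
  also have "\<dots> \<le> ?a" using \<open>1 \<le> k\<close> by simp
  finally have "m < ?a" .
  have "A \<inter> {?a * ?r ^ i..M * (?a * ?r ^ i)} \<noteq> {}" if "i < l" for i
  proof -
    have "i * m \<le> l * m" using that by simp
    with j have "j + i * m < q" by linarith
    have block: "?a * ?r ^ i = M ^ (j + i * m) * k"
      by (simp add: power_add mult_ac flip: power_mult)
    show ?thesis
      unfolding block using avoid[OF that] \<open>j + i * m < q\<close> by (simp add: empty_blocks_def)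
  qed
  with \<open>m < ?r\<close> \<open>m < ?a\<close> show ?thesis by blast
qed

lemma ex_geometric_progressions_meeting:
  assumes "0 < banach_log_density A"
  shows "\<exists>M. \<forall>m. \<exists>a>m. \<exists>r>m. \<forall>i<l. A \<inter> {a * r ^ i..M * (a * r ^ i)} \<noteq> {}"
proof -
  have "0 < 1 / real (2 * l + 1)" by simp
  with assms obtain M where "2 \<le> M" and sparse: "\<And>q. 1 \<le> q \<Longrightarrow>
      \<exists>k\<ge>1. real (card (empty_blocks A M k q)) < 1 / real (2 * l + 1) * real q"
    using ex_few_empty_blocks by blast
  have "\<exists>a>m. \<exists>r>m. \<forall>i<l. A \<inter> {a * r ^ i..M * (a * r ^ i)} \<noteq> {}" for m
  proof -
    define q where "q = 2 * (l + 1) * m + 1"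
    then obtain k where "1 \<le> k"
      and "real (card (empty_blocks A M k q)) < 1 / real (2 * l + 1) * real q"
      using sparse[of q] by auto
    then have "real ((2 * l + 1) * card (empty_blocks A M k q)) < real q"
      by (simp add: field_simps)
    then have "l * card (empty_blocks A M k q) + (l + 1) * m < q"
      unfolding of_nat_less_iff by (simp add: q_def)
    then show ?thesis
      by (rule ex_geometric_progression_few_empty_blocks[OF \<open>2 \<le> M\<close> \<open>1 \<le> k\<close>])
  qed
  then show ?thesis by blast
qed

lemma approximate_subset_Suc:
  assumes "\<And>x. x \<in> X \<Longrightarrow> 0 < x" "\<And>x. x \<in> X \<Longrightarrow> A \<inter> {x..M * x} \<noteq> {}"
  shows "approximate_subset (Suc M) X A"
  unfolding approximate_subset_def
proof
  fix x assume "x \<in> X"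
  then obtain b where "b \<in> A" and b: "0 < x" "x \<le> b" "b \<le> M * x"
    using assms by fastforce
  then have "0 < M" by (cases M) auto
  then have "x < b * Suc M" "b < x * Suc M"
    using b by (auto simp: algebra_simps intro: le_less_trans)
  then have "real x < real b * real (Suc M)" "real b < real x * real (Suc M)"
    by (simp_all only: of_nat_less_iff flip: of_nat_mult)
  then have "is_approximation (Suc M) (real x) (real b)"
    unfolding is_approximation_def by (simp add: pos_divide_less_eq del: of_nat_Suc)
  with \<open>b \<in> A\<close> show "\<exists>a\<in>A. is_approximation (Suc M) (real x) (real a)" ..
qed

theorem theorem3p2:
  fixes A :: "nat set" and l :: nat
  assumes "A \<subseteq> {1..}"
    and "banach_log_density A > 0"
    and "l \<ge> 1"
  shows "\<exists>n::nat. n \<ge> 1 \<and>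
           (\<forall>m::nat. m \<ge> 1 \<longrightarrow>
              (\<exists>a r :: nat. a > m \<and> r > m \<and>
                 approximate_subset n {a * r ^ i | i. i \<in> {0..l - 1}} A))"
proof -
  obtain M where M: "\<And>m. \<exists>a>m. \<exists>r>m. \<forall>i<l. A \<inter> {a * r ^ i..M * (a * r ^ i)} \<noteq> {}"
    using ex_geometric_progressions_meeting[OF assms(2)] by blast
  have "\<exists>a r. a > m \<and> r > m \<and> approximate_subset (Suc M) {a * r ^ i | i. i \<in> {0..l - 1}} A" for m
  proof -
    obtain a r where "a > m" "r > m" "\<And>i. i < l \<Longrightarrow> A \<inter> {a * r ^ i..M * (a * r ^ i)} \<noteq> {}"
      using M by blast
    moreover from this have "approximate_subset (Suc M) {a * r ^ i | i. i \<in> {0..l - 1}} A"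
      using \<open>l \<ge> 1\<close> by (intro approximate_subset_Suc) auto
    ultimately show ?thesis by blast
  qed
  then show ?thesis by (intro exI[of _ "Suc M"]) auto
qed

end
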